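(* Let $X,Y,Z$ be Banach spaces, $U\subset X$ and $V\subset Y$ open sets, let $f:U\to V$ be a continuous map and $Jf$ a pseudo-Jacobian mapping for $f$ on $U$. Suppose that $g:V\to Z$ is a continuous map that is weakly Gâteaux differentiable on $V$, and consider $x\in U$. Then the set $g'(f(x))\circ Jf(x)=\{g'(f(x))\circ T : T\in Jf(x)\}$ is a pseudo-Jacobian of $g\circ f$ at $x$ if one of the following conditions holds: (i) $Jf$ is directionally bounded at $x$ and $g'$ is norm-continuous at $f(x)$ (as a map from $V$ into $\mathcal{L}(Y,Z)$ with the operator norm). (ii) $Jf$ is directionally compact at $x$ and $g'$ is Hadamard continuous at $f(x)$. (iii) $Jf$ is directionally weakly compact at $x$ and $g'$ is weak Hadamard continuous at $f(x)$.
   Context: Banach spaces are real; $\mathcal{L}(X,Y)$ is the space of bounded linear operators from $X$ to $Y$. For $\varphi:U\to\mathbb{R}$ with $U\subset X$ open, $x\in U$ and $v\in X$, $\varphi'_{+}(x;v)=\limsup_{t\to0^+}\frac{\varphi(x+tv)-\varphi(x)}{t}$. For a map $f:U\to Y$ and $x\in U$, a nonempty set $Jf(x)\subset\mathcal{L}(X,Y)$ is a pseudo-Jacobian of $f$ at $x$ if $(y^*\circ f)'_{+}(x;v)\le\sup\{\langle y^*,T(v)\rangle : T\in Jf(x)\}$ for all $y^*\in Y^*$ and $v\in X$. A set-valued mapping $Jf:U\to2^{\mathcal{L}(X,Y)}$ is a pseudo-Jacobian mapping for $f$ on $U$ if $Jf(x)$ is a pseudo-Jacobian of $f$ at $x$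 for every $x\in U$. $Jf$ is directionally bounded (resp. directionally weakly compact, resp. directionally compact) at $x\in U$ if for every $v\in X$ there exists $r>0$ (with $[x,x+rv]\subset U$) such that $Jf([x,x+rv])(v)=\{T(v) : T\in Jf(z),\ z\in[x,x+rv]\}$ is bounded (resp. relatively weakly compact, resp. relatively norm-compact) in $Y$. A map $g:V\to Z$ is weakly Gâteaux differentiable at $y\in V$ if there is $g'(y)\in\mathcal{L}(Y,Z)$ with $\lim_{t\to0}\langle z^*,\frac{g(y+tv)-g(y)}{t}\rangle=\langle z^*,g'(y)(v)\rangle$ for all $v\in Y$ and $z^*\in Z^*$. If $g$ is weakly Gâteaux differentiable on all of $V$, then $g'$ is Hadamard continuous (resp. weak Hadamard continuous) at $y_0\in V$ if for every compact (resp. weakly compact) $K\subset Y$ one has $\sup_{h\in K}\|(g'(y)-g'(y_0))(h)\|\to0$ as $y\to y_0$ in norm. *)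

theory Defs
  imports "HOL-Analysis.Analysis"
begin

text \<open>Maps on an open subset of a space are represented by total functions. All notions below at a
  point \<open>x\<close> depend only on the values near \<open>x\<close>, or are explicitly relative to the open domain.
  The topological dual of \<open>'a\<close> is \<open>'a \<Rightarrow>\<^sub>L real\<close>.\<close>

definition upper_dir_deriv :: "('a::real_normed_vector \<Rightarrow> real) \<Rightarrow> 'a \<Rightarrow> 'a \<Rightarrow> ereal" where
  "upper_dir_deriv \<phi> x v = Limsup (at_right 0) (\<lambda>t. ereal ((\<phi> (x + t *\<^sub>R v) - \<phi> x) / t))"

text \<open>The supremum is taken in the extended reals, so it may be infinite.\<close>

definition pseudo_Jacobian ::
    "('a::real_normed_vector \<Rightarrow> 'b::real_normed_vector) \<Rightarrow> 'a \<Rightarrow> ('a \<Rightarrow>\<^sub>L 'b) set \<Rightarrow> bool" where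
  "pseudo_Jacobian f x J \<longleftrightarrow> J \<noteq> {} \<and>
     (\<forall>(ys :: 'b \<Rightarrow>\<^sub>L real) v. upper_dir_deriv (\<lambda>u. ys (f u)) x v \<le> (SUP T\<in>J. ereal (ys (blinfun_apply T v))))"

definition pseudo_Jacobian_mapping ::
    "('a::real_normed_vector \<Rightarrow> 'b::real_normed_vector) \<Rightarrow> 'a set \<Rightarrow> ('a \<Rightarrow> ('a \<Rightarrow>\<^sub>L 'b) set) \<Rightarrow> bool" where
  "pseudo_Jacobian_mapping f U Jf \<longleftrightarrow> (\<forall>x\<in>U. pseudo_Jacobian f x (Jf x))"

text \<open>The coarsest topology for which all bounded linear functionals are continuous.\<close>

definition weak_topology :: "'a::real_normed_vector topology" where
  "weak_topology = pullback_topology UNIV (\<lambda>x (xs :: 'a \<Rightarrow>\<^sub>L real). blinfun_apply xs x)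
     (product_topology (\<lambda>_. euclideanreal) UNIV)"

lemma topspace_weak_topology [simp]: "topspace weak_topology = UNIV"
  by (simp add: weak_topology_def topspace_pullback_topology)

lemma continuous_map_into_weak_topology_iff:
  "continuous_map X weak_topology h \<longleftrightarrow>
     (\<forall>xs :: 'a::real_normed_vector \<Rightarrow>\<^sub>L real. continuous_map X euclideanreal (\<lambda>p. xs (h p)))"
proof
  assume h: "continuous_map X weak_topology h"
  have "continuous_map weak_topology euclideanreal (blinfun_apply xs)" for xs :: "'a \<Rightarrow>\<^sub>L real"
    using continuous_map_pullback[OF continuous_map_product_projection[of xs UNIV "\<lambda>_. euclideanreal"],
        of UNIV "\<lambda>x xs. blinfun_apply xs x"]
    by (simp add: weak_topology_def o_def)
  from continuous_map_compose[OF h this]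
  show "\<forall>xs :: 'a \<Rightarrow>\<^sub>L real. continuous_map X euclideanreal (\<lambda>p. xs (h p))"
    by (simp add: o_def)
next
  assume "\<forall>xs :: 'a \<Rightarrow>\<^sub>L real. continuous_map X euclideanreal (\<lambda>p. xs (h p))"
  then show "continuous_map X weak_topology h"
    unfolding weak_topology_def
    by (intro continuous_map_pullback') (auto simp: o_def continuous_map_componentwise)
qed

definition weakly_compact :: "'a::real_normed_vector set \<Rightarrow> bool" where
  "weakly_compact K \<longleftrightarrow> compactin weak_topology K"

definition relatively_weakly_compact :: "'a::real_normed_vector set \<Rightarrow> bool" where
  "relatively_weakly_compact S \<longleftrightarrow> weakly_compact (weak_topology closure_of S)"

definition relatively_compact :: "'a::real_normed_vector set \<Rightarrow> bool" where
  "relatively_compact S \<longleftrightarrow> compact (closure S)"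

text \<open>\<open>segment_image Jf x v r\<close> is the set \<open>Jf([x, x + r v])(v)\<close>.\<close>

definition segment_image ::
    "('a::real_normed_vector \<Rightarrow> ('a \<Rightarrow>\<^sub>L 'b::real_normed_vector) set) \<Rightarrow> 'a \<Rightarrow> 'a \<Rightarrow> real \<Rightarrow> 'b set" where
  "segment_image Jf x v r = {blinfun_apply T v | T z. z \<in> closed_segment x (x + r *\<^sub>R v) \<and> T \<in> Jf z}"

definition directionally_bounded ::
    "'a::real_normed_vector set \<Rightarrow> ('a \<Rightarrow> ('a \<Rightarrow>\<^sub>L 'b::real_normed_vector) set) \<Rightarrow> 'a \<Rightarrow> bool" where
  "directionally_bounded U Jf x \<longleftrightarrow>
     (\<forall>v. \<exists>r>0. closed_segment x (x + r *\<^sub>R v) \<subseteq> U \<and> bounded (segment_image Jf x v r))"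

definition directionally_weakly_compact ::
    "'a::real_normed_vector set \<Rightarrow> ('a \<Rightarrow> ('a \<Rightarrow>\<^sub>L 'b::real_normed_vector) set) \<Rightarrow> 'a \<Rightarrow> bool" where
  "directionally_weakly_compact U Jf x \<longleftrightarrow>
     (\<forall>v. \<exists>r>0. closed_segment x (x + r *\<^sub>R v) \<subseteq> U \<and>
        relatively_weakly_compact (segment_image Jf x v r))"

definition directionally_compact ::
    "'a::real_normed_vector set \<Rightarrow> ('a \<Rightarrow> ('a \<Rightarrow>\<^sub>L 'b::real_normed_vector) set) \<Rightarrow> 'a \<Rightarrow> bool" where
  "directionally_compact U Jf x \<longleftrightarrow>
     (\<forall>v. \<exists>r>0. closed_segment x (x + r *\<^sub>R v) \<subseteq> U \<and> relatively_compact (segment_image Jf x v r))"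

definition has_weak_Gateaux_derivative ::
    "('b::real_normed_vector \<Rightarrow> 'c::real_normed_vector) \<Rightarrow> ('b \<Rightarrow>\<^sub>L 'c) \<Rightarrow> 'b \<Rightarrow> bool" where
  "has_weak_Gateaux_derivative g D y \<longleftrightarrow>
     (\<forall>v (zs :: 'c \<Rightarrow>\<^sub>L real). ((\<lambda>t::real. zs ((g (y + t *\<^sub>R v) - g y) /\<^sub>R t)) \<longlongrightarrow> zs (D v)) (at 0))"

text \<open>The suprema are taken in \<open>ennreal\<close>, so they are meaningful (with value \<open>0\<close>) also for the
  empty set, where the real-valued supremum is unspecified.\<close>

definition Hadamard_continuous_at ::
    "'b::real_normed_vector set \<Rightarrow> ('b \<Rightarrow> 'b \<Rightarrow>\<^sub>L 'c::real_normed_vector) \<Rightarrow> 'b \<Rightarrow> bool" where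
  "Hadamard_continuous_at V g' y0 \<longleftrightarrow>
     (\<forall>K. compact K \<longrightarrow> ((\<lambda>y. SUP h\<in>K. ennreal (norm ((g' y - g' y0) h))) \<longlongrightarrow> 0) (at y0 within V))"

definition weak_Hadamard_continuous_at ::
    "'b::real_normed_vector set \<Rightarrow> ('b \<Rightarrow> 'b \<Rightarrow>\<^sub>L 'c::real_normed_vector) \<Rightarrow> 'b \<Rightarrow> bool" where
  "weak_Hadamard_continuous_at V g' y0 \<longleftrightarrow>
     (\<forall>K. weakly_compact K \<longrightarrow>
        ((\<lambda>y. SUP h\<in>K. ennreal (norm ((g' y - g' y0) h))) \<longlongrightarrow> 0) (at y0 within V))"

end

theory Submission
  imports Defs
begin

text \<open>
  Fix a functional \<open>zs\<close> on \<open>'c\<close> and a direction \<open>v\<close>, write \<open>y0 = f x\<close> and let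
  \<open>q t = (f (x + t v) - f x) / t\<close>. For small \<open>t > 0\<close> the classical mean value theorem, applied to
  \<open>zs \<circ> g\<close> on the segment from \<open>y0\<close> to \<open>f (x + t v)\<close>, yields a point \<open>y\<close> of that segment such that
  the difference quotient of \<open>zs \<circ> g \<circ> f\<close> equals
  \<open>zs (g' y (q t)) = zs (g' y0 (q t)) + zs ((g' y - g' y0) (q t))\<close>.
  The first summand is a difference quotient of \<open>(zs \<circ> g' y0) \<circ> f\<close>, and its upper limit is
  controlled by the pseudo-Jacobian of \<open>f\<close> at \<open>x\<close>. It remains to see that the second one has upper
  limit at most \<open>0\<close>.

  For this, \<open>zs \<circ> (g' y - g' y0)\<close> is regarded as one more functional on \<open>'b\<close>. A mean value
  inequality for pseudo-Jacobians along the segment \<open>[x, x + t v]\<close>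
  (\<open>functional_increment_le_of_pseudo_Jacobian\<close>) bounds its value at \<open>q t\<close> by its supremum
  over \<open>B = Jf [x, x + r v] v\<close>, hence by \<open>norm zs\<close> times the supremum of \<open>norm ((g' y - g' y0) h)\<close>
  over \<open>h \<in> B\<close>. Since \<open>y\<close> tends to \<open>y0\<close> by continuity of \<open>f\<close>, all that is required of \<open>g'\<close> is
  convergence uniform on the single set \<open>B\<close>, and each of the three hypotheses provides this
  (\<open>uniform_convergence_of_derivative\<close>).
  The vectors \<open>q t\<close> themselves lie only in the closed convex hull of \<open>B\<close>. Testing with functionals
  avoids passing to that hull, whose weak compactness in the third case would be the
  Krein--Smulian theorem.
\<close>

section \<open>Mean value inequality for pseudo-Jacobians\<close>

text \<open>The last parameter at which \<open>w t - (c + e) * t\<close> is at most its initial value must be the right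
  end point, as the bound on the Dini derivative allows one to move further to the right from any
  earlier one.\<close>

lemma increment_le_of_upper_right_Dini_le:
  fixes w :: "real \<Rightarrow> real"
  assumes cont: "continuous_on {0..b} w" and b: "0 \<le> b"
    and Dini: "\<And>s. 0 \<le> s \<Longrightarrow> s < b \<Longrightarrow> Limsup (at_right 0) (\<lambda>h. ereal ((w (s + h) - w s) / h)) \<le> ereal c"
  shows "w b - w 0 \<le> c * b"
proof -
  have main: "w b - w 0 \<le> (c + e) * b" if e: "e > 0" for e
  proof -
    define u where "u = (\<lambda>s. w s - (c + e) * s)"
    define S where "S = {s \<in> {0..b}. u s \<le> w 0}"
    have "continuous_on {0..b} u"
      unfolding u_def by (intro continuous_intros cont)
    then have "closed S"
      unfolding S_def by (intro continuous_on_closed_Collect_le) auto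
    moreover have "bounded S"
      by (rule bounded_subset[of "{0..b}"]) (auto simp: S_def)
    moreover have "0 \<in> S"
      using b by (simp add: S_def u_def)
    ultimately obtain s where s: "s \<in> S" and smax: "\<And>r. r \<in> S \<Longrightarrow> r \<le> s"
      using compact_attains_sup[of S] by (auto simp: compact_eq_bounded_closed)
    have "s = b"
    proof (rule ccontr)
      assume "s \<noteq> b"
      with s have sb: "0 \<le> s" "s < b" by (auto simp: S_def)
      have "Limsup (at_right 0) (\<lambda>h. ereal ((w (s + h) - w s) / h)) < ereal (c + e)"
        using Dini[OF sb] e by (meson le_less_trans less_add_same_cancel1 less_ereal.simps(1))
      then have "eventually (\<lambda>h. ereal ((w (s + h) - w s) / h) < ereal (c + e)) (at_right 0)"
        by (rule Limsup_lessD)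
      moreover have "eventually (\<lambda>h. h \<in> {0<..<b - s}) (at_right 0)"
        using sb by (intro eventually_at_right_real) auto
      ultimately have "eventually (\<lambda>h. (w (s + h) - w s) / h < c + e \<and> h \<in> {0<..<b - s}) (at_right 0)"
        by eventually_elim simp
      then obtain h where h: "(w (s + h) - w s) / h < c + e" "0 < h" "h < b - s"
        using eventually_happens'[OF trivial_limit_at_right_real] by fastforce
      then have "w (s + h) - w s < (c + e) * h"
        by (simp add: pos_divide_less_eq)
      then have "u (s + h) \<le> u s"
        by (simp add: u_def algebra_simps)
      with s sb h have "s + h \<in> S" by (auto simp: S_def)
      from smax[OF this] h show False by simp
    qed
    with s show ?thesis by (simp add: S_def u_def)
  qed
  have "w b - w 0 \<le> c * b + \<epsilon>" if "\<epsilon> > 0" for \<epsilon>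
  proof (cases "b = 0")
    case False
    with main[of "\<epsilon> / b"] b that show ?thesis by (simp add: distrib_right)
  qed (use that in simp)
  then show ?thesis by (rule field_le_epsilon)
qed

text \<open>Along the segment, \<open>s \<mapsto> ys (f (x + s v))\<close> is a real function, and its upper right Dini
  derivative at \<open>s\<close> is the upper directional derivative of \<open>ys \<circ> f\<close> at \<open>x + s v\<close>. A one-sided bound
  on \<open>ys\<close> over \<open>segment_image\<close> therefore transfers to the increments of \<open>ys \<circ> f\<close>.\<close>

lemma functional_increment_le_of_pseudo_Jacobian:
  fixes f :: "'a::real_normed_vector \<Rightarrow> 'b::real_normed_vector" and ys :: "'b \<Rightarrow>\<^sub>L real"
  assumes cont: "continuous_on U f" and pJ: "pseudo_Jacobian_mapping f U Jf"
    and seg: "closed_segment x (x + r *\<^sub>R v) \<subseteq> U"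
    and t: "0 \<le> t" "t \<le> r"
    and bound: "\<And>h. h \<in> segment_image Jf x v r \<Longrightarrow> ys h \<le> c"
  shows "ys (f (x + t *\<^sub>R v) - f x) \<le> c * t"
proof -
  have in_seg: "x + s *\<^sub>R v \<in> closed_segment x (x + r *\<^sub>R v)" if "0 \<le> s" "s \<le> t" for s
  proof (cases "r = 0")
    case False
    with that t have "0 \<le> s / r" "s / r \<le> 1" by auto
    moreover have "x + s *\<^sub>R v = (1 - s / r) *\<^sub>R x + (s / r) *\<^sub>R (x + r *\<^sub>R v)"
      using False by (simp add: algebra_simps)
    ultimately show ?thesis unfolding in_segment by blast
  qed (use that t in auto)
  define w where "w = (\<lambda>s. ys (f (x + s *\<^sub>R v)))"
  have "continuous_on {0..t} w"
    unfolding w_def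
    by (intro continuous_intros continuous_on_compose2[OF cont]) (use in_seg seg in auto)
  moreover have "Limsup (at_right 0) (\<lambda>h. ereal ((w (s + h) - w s) / h)) \<le> ereal c"
    if s: "0 \<le> s" "s < t" for s
  proof -
    let ?z = "x + s *\<^sub>R v"
    have z: "?z \<in> closed_segment x (x + r *\<^sub>R v)" using in_seg s by simp
    then have "pseudo_Jacobian f ?z (Jf ?z)"
      using pJ seg by (auto simp: pseudo_Jacobian_mapping_def)
    then have "upper_dir_deriv (\<lambda>u. ys (f u)) ?z v \<le> (SUP T\<in>Jf ?z. ereal (ys (blinfun_apply T v)))"
      by (simp add: pseudo_Jacobian_def)
    also have "\<dots> \<le> ereal c"
      using z by (intro SUP_least) (force intro!: bound simp: segment_image_def)
    finally show ?thesis
      by (simp add: upper_dir_deriv_def w_def algebra_simps)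
  qed
  ultimately have "w t - w 0 \<le> c * t"
    using t by (intro increment_le_of_upper_right_Dini_le) auto
  then show ?thesis by (simp add: w_def blinfun.diff_right)
qed

section \<open>Mean value theorem for weak Gateaux derivatives\<close>

text \<open>Composed with a functional, \<open>g\<close> restricted to the segment is differentiable in the ordinary
  sense. The intermediate point depends on \<open>zs\<close>.\<close>

lemma weak_Gateaux_mean_value:
  fixes g :: "'b::real_normed_vector \<Rightarrow> 'c::real_normed_vector" and zs :: "'c \<Rightarrow>\<^sub>L real"
  assumes deriv: "\<And>y. y \<in> closed_segment a b \<Longrightarrow> has_weak_Gateaux_derivative g (g' y) y"
  obtains y where "y \<in> closed_segment a b" "zs (g b - g a) = zs (g' y (b - a))"
proof -
  define \<phi> where "\<phi> = (\<lambda>s. zs (g (a + s *\<^sub>R (b - a))))"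
  have seg: "a + s *\<^sub>R (b - a) \<in> closed_segment a b" if "0 \<le> s" "s \<le> 1" for s
    using that by (auto simp: in_segment algebra_simps intro!: exI[of _ s])
  have "(\<phi> has_field_derivative zs (g' (a + s *\<^sub>R (b - a)) (b - a))) (at s)"
    if "0 \<le> s" "s \<le> 1" for s
  proof -
    have "((\<lambda>h. zs ((g (a + s *\<^sub>R (b - a) + h *\<^sub>R (b - a)) - g (a + s *\<^sub>R (b - a))) /\<^sub>R h))
        \<longlongrightarrow> zs (g' (a + s *\<^sub>R (b - a)) (b - a))) (at 0)"
      using deriv[OF seg[OF that]] by (simp add: has_weak_Gateaux_derivative_def)
    moreover have "zs ((g (a + s *\<^sub>R (b - a) + h *\<^sub>R (b - a)) - g (a + s *\<^sub>R (b - a))) /\<^sub>R h)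
        = (\<phi> (s + h) - \<phi> s) / h" for h
      by (simp add: \<phi>_def blinfun.diff_right blinfun.scaleR_right divide_inverse_commute
          scaleR_add_left add.assoc)
    ultimately show ?thesis by (simp add: DERIV_def)
  qed
  then obtain s where s: "0 < s" "s < 1"
    and "\<phi> 1 - \<phi> 0 = (1 - 0) * zs (g' (a + s *\<^sub>R (b - a)) (b - a))"
    using MVT2[of 0 1 \<phi> "\<lambda>s. zs (g' (a + s *\<^sub>R (b - a)) (b - a))"] by auto
  then have "zs (g b - g a) = zs (g' (a + s *\<^sub>R (b - a)) (b - a))"
    by (simp add: \<phi>_def blinfun.diff_right)
  with seg[of s] s show ?thesis by (intro that) auto
qed

section \<open>Uniform convergence of the derivative on directional images\<close>

text \<open>The limit is punctured, but the bound extends to \<open>y = y0\<close>, where the difference vanishes.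
  This matters below, as an intermediate point may coincide with \<open>y0\<close>.\<close>

lemma uniform_bound_of_SUP_tendsto_0:
  fixes g' :: "'b::real_normed_vector \<Rightarrow> 'b \<Rightarrow>\<^sub>L 'c::real_normed_vector"
  assumes "((\<lambda>y. SUP h\<in>K. ennreal (norm ((g' y - g' y0) h))) \<longlongrightarrow> 0) (at y0 within V)"
    and "B \<subseteq> K" and "e > 0"
  shows "\<exists>d>0. \<forall>y\<in>V. dist y y0 < d \<longrightarrow> (\<forall>h\<in>B. norm ((g' y - g' y0) h) \<le> e)"
proof -
  have "eventually (\<lambda>y. (SUP h\<in>K. ennreal (norm ((g' y - g' y0) h))) < ennreal e) (at y0 within V)"
    using assms by (intro order_tendstoD) auto
  then obtain d where d: "d > 0" "\<And>y. y \<in> V \<Longrightarrow> y \<noteq> y0 \<Longrightarrow> dist y y0 < d \<Longrightarrow>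
      (SUP h\<in>K. ennreal (norm ((g' y - g' y0) h))) < ennreal e"
    unfolding eventually_at by auto
  have "norm ((g' y - g' y0) h) \<le> e" if "y \<in> V" "dist y y0 < d" "h \<in> B" for y h
  proof (cases "y = y0")
    case False
    have "ennreal (norm ((g' y - g' y0) h)) \<le> (SUP h\<in>K. ennreal (norm ((g' y - g' y0) h)))"
      using that \<open>B \<subseteq> K\<close> by (intro SUP_upper) auto
    also have "\<dots> < ennreal e" using d(2) that False by auto
    finally show ?thesis using \<open>e > 0\<close> by (simp add: ennreal_less_iff)
  qed (use \<open>e > 0\<close> in simp)
  with d(1) show ?thesis by blast
qed

lemma uniform_bound_of_continuous:
  fixes g' :: "'b::real_normed_vector \<Rightarrow> 'b \<Rightarrow>\<^sub>L 'c::real_normed_vector"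
  assumes cont: "continuous (at y0 within V) g'" and "bounded B" and "e > 0"
  shows "\<exists>d>0. \<forall>y\<in>V. dist y y0 < d \<longrightarrow> (\<forall>h\<in>B. norm ((g' y - g' y0) h) \<le> e)"
proof -
  obtain M where M: "M > 0" "\<And>h. h \<in> B \<Longrightarrow> norm h \<le> M"
    using \<open>bounded B\<close> by (auto simp: bounded_pos)
  obtain d where d: "d > 0" "\<And>y. y \<in> V \<Longrightarrow> dist y y0 < d \<Longrightarrow> dist (g' y) (g' y0) < e / M"
    using cont M(1) \<open>e > 0\<close> unfolding continuous_within_eps_delta by (metis divide_pos_pos)
  have "norm ((g' y - g' y0) h) \<le> e" if "y \<in> V" "dist y y0 < d" "h \<in> B" for y h
  proof -
    have "norm ((g' y - g' y0) h) \<le> norm (g' y - g' y0) * norm h"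
      by (rule norm_blinfun)
    also have "\<dots> \<le> (e / M) * M"
      using d(2)[OF that(1,2)] M that(3) \<open>e > 0\<close> by (intro mult_mono) (auto simp: dist_norm)
    finally show ?thesis using M(1) by simp
  qed
  with d(1) show ?thesis by blast
qed

text \<open>The three alternatives enter the chain rule only through this consequence. In the two compact
  cases the continuity of \<open>g'\<close> is tested on the closure, respectively the weak closure, of the
  directional image.\<close>

lemma uniform_convergence_of_derivative:
  fixes Jf :: "'a::real_normed_vector \<Rightarrow> ('a \<Rightarrow>\<^sub>L 'b::real_normed_vector) set"
    and g' :: "'b \<Rightarrow> 'b \<Rightarrow>\<^sub>L 'c::real_normed_vector"
  assumes "(directionally_bounded U Jf x \<and> continuous (at y0 within V) g')
       \<or> (directionally_compact U Jf x \<and> Hadamard_continuous_at V g' y0)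
       \<or> (directionally_weakly_compact U Jf x \<and> weak_Hadamard_continuous_at V g' y0)"
  obtains r where "r > 0" "closed_segment x (x + r *\<^sub>R v) \<subseteq> U"
    "\<And>e. e > 0 \<Longrightarrow> \<exists>d>0. \<forall>y\<in>V. dist y y0 < d \<longrightarrow>
       (\<forall>h\<in>segment_image Jf x v r. norm ((g' y - g' y0) h) \<le> e)"
  using assms
proof (elim disjE conjE)
  assume "directionally_bounded U Jf x" and cont: "continuous (at y0 within V) g'"
  then obtain r where "r > 0" "closed_segment x (x + r *\<^sub>R v) \<subseteq> U"
    and "bounded (segment_image Jf x v r)"
    unfolding directionally_bounded_def by blast
  then show thesis using that uniform_bound_of_continuous[OF cont] by blast
next
  assume "directionally_compact U Jf x" and H: "Hadamard_continuous_at V g' y0"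
  then obtain r where "r > 0" "closed_segment x (x + r *\<^sub>R v) \<subseteq> U"
    and "compact (closure (segment_image Jf x v r))"
    unfolding directionally_compact_def relatively_compact_def by blast
  then show thesis
    using that uniform_bound_of_SUP_tendsto_0[OF _ closure_subset] H
    unfolding Hadamard_continuous_at_def by blast
next
  assume "directionally_weakly_compact U Jf x" and H: "weak_Hadamard_continuous_at V g' y0"
  then obtain r where "r > 0" "closed_segment x (x + r *\<^sub>R v) \<subseteq> U"
    and "weakly_compact (weak_topology closure_of segment_image Jf x v r)"
    unfolding directionally_weakly_compact_def relatively_weakly_compact_def by blast
  moreover have "segment_image Jf x v r \<subseteq> weak_topology closure_of segment_image Jf x v r"
    by (rule closure_of_subset) simp
  ultimately show thesis
    using that uniform_bound_of_SUP_tendsto_0 H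
    unfolding weak_Hadamard_continuous_at_def by blast
qed

section \<open>The chain rule\<close>

theorem theorem2p15:
  fixes U :: "'a::banach set" and V :: "'b::banach set"
    and f :: "'a \<Rightarrow> 'b" and g :: "'b \<Rightarrow> 'c::banach"
    and Jf :: "'a \<Rightarrow> ('a \<Rightarrow>\<^sub>L 'b) set" and g' :: "'b \<Rightarrow> 'b \<Rightarrow>\<^sub>L 'c" and x :: 'a
  assumes "open U" and "open V"
    and "continuous_on U f" and "f ` U \<subseteq> V"
    and "pseudo_Jacobian_mapping f U Jf"
    and "continuous_on V g"
    and "\<And>y. y \<in> V \<Longrightarrow> has_weak_Gateaux_derivative g (g' y) y"
    and "x \<in> U"
    and "(directionally_bounded U Jf x \<and> continuous (at (f x) within V) g')
       \<or> (directionally_compact U Jf x \<and> Hadamard_continuous_at V g' (f x))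
       \<or> (directionally_weakly_compact U Jf x \<and> weak_Hadamard_continuous_at V g' (f x))"
  shows "pseudo_Jacobian (g \<circ> f) x ((\<lambda>T. g' (f x) o\<^sub>L T) ` Jf x)"
  unfolding pseudo_Jacobian_def
proof (intro conjI allI)
  have pJx: "pseudo_Jacobian f x (Jf x)"
    using assms(5,8) by (simp add: pseudo_Jacobian_mapping_def)
  then show "(\<lambda>T. g' (f x) o\<^sub>L T) ` Jf x \<noteq> {}" by (simp add: pseudo_Jacobian_def)
  fix zs :: "'c \<Rightarrow>\<^sub>L real" and v :: 'a
  define y0 where "y0 = f x"
  define S where "S = (SUP T\<in>Jf x. ereal (zs (g' y0 (blinfun_apply T v))))"
  obtain r where r: "r > 0" "closed_segment x (x + r *\<^sub>R v) \<subseteq> U"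
    and unif: "\<And>e. e > 0 \<Longrightarrow> \<exists>d>0. \<forall>y\<in>V. dist y y0 < d \<longrightarrow>
       (\<forall>h\<in>segment_image Jf x v r. norm ((g' y - g' y0) h) \<le> e)"
    using uniform_convergence_of_derivative[OF assms(9)] unfolding y0_def by metis
  have "y0 \<in> V" using assms(4,8) by (auto simp: y0_def)
  then obtain \<rho> where \<rho>: "\<rho> > 0" "ball y0 \<rho> \<subseteq> V"
    using \<open>open V\<close> by (auto simp: open_contains_ball)
  let ?quot = "\<lambda>t. (zs (g (f (x + t *\<^sub>R v))) - zs (g (f x))) / t"
  let ?lin = "\<lambda>t. ((zs o\<^sub>L g' y0) (f (x + t *\<^sub>R v)) - (zs o\<^sub>L g' y0) (f x)) / t"
  have quotient_le: "eventually (\<lambda>t. ?quot t \<le> ?lin t + e) (at_right 0)" if "e > 0" for e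
  proof -
    \<comment> \<open>The \<open>+ 1\<close> covers \<open>zs = 0\<close>.\<close>
    define \<eta> where "\<eta> = e / (norm zs + 1)"
    have "norm zs + 1 > 0" by (simp add: add_nonneg_pos)
    then have \<eta>: "\<eta> > 0" "norm zs * \<eta> \<le> e"
      using \<open>e > 0\<close> by (auto simp: \<eta>_def field_simps)
    obtain d where d: "d > 0" "\<And>y h. y \<in> V \<Longrightarrow> dist y y0 < d \<Longrightarrow>
        h \<in> segment_image Jf x v r \<Longrightarrow> norm ((g' y - g' y0) h) \<le> \<eta>"
      using unif[OF \<eta>(1)] by blast
    have "isCont f x"
      using assms(1,3,8) by (simp add: continuous_on_eq_continuous_at)
    moreover have "((\<lambda>t::real. x + t *\<^sub>R v) \<longlongrightarrow> x + 0 *\<^sub>R v) (at_right 0)"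
      by (intro tendsto_intros)
    then have "((\<lambda>t::real. x + t *\<^sub>R v) \<longlongrightarrow> x) (at_right 0)" by simp
    ultimately have "((\<lambda>t::real. f (x + t *\<^sub>R v)) \<longlongrightarrow> y0) (at_right 0)"
      unfolding y0_def by (rule isCont_tendsto_compose)
    then have "eventually (\<lambda>t. dist (f (x + t *\<^sub>R v)) y0 < min d \<rho>) (at_right 0)"
      using d(1) \<rho>(1) by (intro tendstoD) auto
    moreover have "eventually (\<lambda>t. t \<in> {0<..<r}) (at_right 0)"
      using r(1) by (rule eventually_at_right_real)
    ultimately show ?thesis
    proof eventually_elim
      case (elim t)
      let ?b = "f (x + t *\<^sub>R v)"
      have "closed_segment y0 ?b \<subseteq> ball y0 (min d \<rho>)"
        using elim d(1) \<rho>(1) by (intro closed_segment_subset) (auto simp: dist_commute)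
      then have near: "y \<in> V \<and> dist y y0 < d" if "y \<in> closed_segment y0 ?b" for y
        using that \<rho>(2) by (force simp: dist_commute)
      then obtain y where "y \<in> closed_segment y0 ?b"
        and y: "zs (g ?b - g y0) = zs (g' y (?b - y0))"
        using weak_Gateaux_mean_value[of y0 ?b g g' zs] assms(7) by blast
      with near have yV: "y \<in> V" "dist y y0 < d" by auto
      \<comment> \<open>With \<open>y\<close> now fixed, the error term is itself the increment of a functional composed with
        \<open>f\<close>, so the mean value inequality on the directional image applies to it.\<close>
      have "(zs o\<^sub>L (g' y - g' y0)) (?b - f x) \<le> e * t"
      proof (rule functional_increment_le_of_pseudo_Jacobian[OF assms(3,5) r(2)])
        fix h assume "h \<in> segment_image Jf x v r"
        then have "norm ((g' y - g' y0) h) \<le> \<eta>" using d(2) yV by blast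
        then have "norm zs * norm ((g' y - g' y0) h) \<le> norm zs * \<eta>"
          by (intro mult_left_mono) auto
        with \<eta>(2) norm_blinfun[of zs "(g' y - g' y0) h"]
        show "(zs o\<^sub>L (g' y - g' y0)) h \<le> e" by simp
      qed (use elim in auto)
      then have "zs (g ?b) - zs (g (f x))
          \<le> (zs o\<^sub>L g' y0) ?b - (zs o\<^sub>L g' y0) (f x) + e * t"
        using y by (simp add: y0_def blinfun.diff_right blinfun.diff_left)
      then have "?quot t \<le> ((zs o\<^sub>L g' y0) ?b - (zs o\<^sub>L g' y0) (f x) + e * t) / t"
        using elim by (intro divide_right_mono) auto
      also have "\<dots> = ?lin t + e"
        using elim by (simp add: add_divide_distrib)
      finally show ?case .
    qed
  qed
  have "upper_dir_deriv (\<lambda>u. (zs o\<^sub>L g' y0) (f u)) x v \<le> (SUP T\<in>Jf x. ereal ((zs o\<^sub>L g' y0) (blinfun_apply T v)))"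
    using pJx unfolding pseudo_Jacobian_def by blast
  then have q0: "Limsup (at_right 0) (\<lambda>t. ereal (?lin t)) \<le> S"
    by (simp add: upper_dir_deriv_def S_def)
  have "Limsup (at_right 0) (\<lambda>t. ereal (?quot t)) \<le> S"
  proof (rule ereal_le_epsilon2)
    fix e :: real assume "e > 0"
    have "Limsup (at_right 0) (\<lambda>t. ereal (?quot t)) \<le> Limsup (at_right 0) (\<lambda>t. ereal (?lin t) + ereal e)"
      using quotient_le[OF \<open>e > 0\<close>] by (intro Limsup_mono) simp
    also have "\<dots> = Limsup (at_right 0) (\<lambda>t. ereal (?lin t)) + ereal e"
      by (rule Limsup_add_ereal_right) auto
    finally show "Limsup (at_right 0) (\<lambda>t. ereal (?quot t)) \<le> S + ereal e"
      using add_right_mono[OF q0] by (rule order_trans)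
  qed
  then show "upper_dir_deriv (\<lambda>u. zs ((g \<circ> f) u)) x v
      \<le> (SUP T\<in>(\<lambda>T. g' (f x) o\<^sub>L T) ` Jf x. ereal (zs (blinfun_apply T v)))"
    by (simp add: upper_dir_deriv_def S_def y0_def image_image)
qed

end
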